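(* Consider the nonlinear pricing problem with verification (quantity space $Q=\mathbb{R}_+$, exponential authentication rate $\alpha$ with local precision function $\lambda$, type density $f$, and cost function $c$ with $c'(0)=0$, $c'$ strictly increasing, and $\lim_{q\to\infty}c'(q)>\bar\theta$). Assume that the virtual value $$\varphi(\theta)=\theta-\frac{1}{f(\theta)}\int_\theta^{\bar\theta}\alpha(\theta|\xi)f(\xi)\,d\xi$$ is weakly increasing on $[\underline\theta,\bar\theta]$. Then the optimal quantity function $q^\ast$ and transfer function $t^\ast$ (i.e. the solution of the principal's problem) are essentially unique and given by $$c'(q^\ast(\theta))=\varphi(\theta)_+,\qquad t^\ast(\theta)=\theta q^\ast(\theta)-\int_{\underline\theta}^{\theta}\alpha(\xi|\theta)\,q^\ast(\xi)\,d\xi .$$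
   Context: Types: $\Theta=[\underline\theta,\bar\theta]$ with $\bar\theta>\underline\theta\ge0$; the type has distribution function $F$ with strictly positive density $f$ on $\Theta$. Authentication rate: for a given continuous $\lambda\colon[\underline\theta,\bar\theta]\to\mathbb{R}_+$, $$\alpha(\theta'|\theta)=\exp\Big(-\Big|\int_{\theta'}^{\theta}\lambda(\xi)\,d\xi\Big|\Big),\qquad\theta,\theta'\in\Theta.$$ Quantity space $Q=\mathbb{R}_+$; the cost function $c\colon Q\to\mathbb{R}_+$ is differentiable and (weakly) convex. A mechanism is a pair of (universally) measurable functions $q\colon\Theta\to Q$ and $t\colon\Theta\to\mathbb{R}$. The principal's problem is $$\text{maximize}\ \int_{\underline\theta}^{\bar\theta}[t(\theta)-c(q(\theta))]f(\theta)\,d\theta$$ subject to $$\theta q(\theta)-t(\theta)\ge\alpha(\theta'|\theta)\,[\theta q(\theta')-t(\theta')]\quad\text{for all }\theta,\theta'\in\Theta,\qquad \theta q(\theta)-t(\theta)\ge0\quad\text{for all }\theta\in\Theta.$$ A mechanism is optimal if it solves this problem. Essentially unique means that all optimal mechanisms agree at almost every type. Notation: $y_+=\max\{y,0\}$. *)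

theory Defs
  imports "HOL-Probability.Probability"
begin

definition universally_measurable_on :: "real set \<Rightarrow> (real \<Rightarrow> real) \<Rightarrow> bool" where
  "universally_measurable_on S g \<longleftrightarrow>
     (\<forall>M. finite_measure M \<and> sets M = sets (restrict_space borel S)
        \<longrightarrow> g \<in> borel_measurable (completion M))"

(* auth_rate l \<theta>' \<theta> is \<alpha>(\<theta>'|\<theta>): type \<theta> is authenticated as \<theta>'. The interval integral
   is oriented, so the absolute value makes the rate symmetric. *)
definition auth_rate :: "(real \<Rightarrow> real) \<Rightarrow> real \<Rightarrow> real \<Rightarrow> real" where
  "auth_rate l \<theta>' \<theta> = exp (- \<bar>LBINT \<xi>=ereal \<theta>'..ereal \<theta>. l \<xi>\<bar>)"

definition virtual_value :: "real \<Rightarrow> (real \<Rightarrow> real) \<Rightarrow> (real \<Rightarrow> real) \<Rightarrow> real \<Rightarrow> real" where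
  "virtual_value hi l f \<theta> =
     \<theta> - 1 / f \<theta> * (LBINT \<xi>=ereal \<theta>..ereal hi. auth_rate l \<theta> \<xi> * f \<xi>)"

(* Built on the completed Lebesgue measure because universally measurable functions
   need not be Borel. *)
definition type_distribution :: "real \<Rightarrow> real \<Rightarrow> (real \<Rightarrow> real) \<Rightarrow> real measure" where
  "type_distribution lo hi f = density (lebesgue_on {lo..hi}) (\<lambda>\<theta>. ennreal (f \<theta>))"

definition mechanism :: "real \<Rightarrow> real \<Rightarrow> (real \<Rightarrow> real) \<Rightarrow> (real \<Rightarrow> real) \<Rightarrow> bool" where
  "mechanism lo hi q t \<longleftrightarrow>
     universally_measurable_on {lo..hi} q \<and> universally_measurable_on {lo..hi} t \<and>
     (\<forall>\<theta>\<in>{lo..hi}. 0 \<le> q \<theta>)"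

definition feasible ::
  "real \<Rightarrow> real \<Rightarrow> (real \<Rightarrow> real) \<Rightarrow> (real \<Rightarrow> real) \<Rightarrow> (real \<Rightarrow> real) \<Rightarrow> bool" where
  "feasible lo hi l q t \<longleftrightarrow>
     mechanism lo hi q t \<and>
     (\<forall>\<theta>\<in>{lo..hi}. \<forall>\<theta>'\<in>{lo..hi}.
        \<theta> * q \<theta> - t \<theta> \<ge> auth_rate l \<theta>' \<theta> * (\<theta> * q \<theta>' - t \<theta>')) \<and>
     (\<forall>\<theta>\<in>{lo..hi}. \<theta> * q \<theta> - t \<theta> \<ge> 0)"

(* Not the Bochner integral, which would assign value 0 to a mechanism whose expected profit
   is -\<infinity>. The convention \<infinity> - \<infinity> = \<infinity> of ereal is harmless: if the marginal cost eventually
   exceeds hi, feasibility bounds t \<theta> - c (q \<theta>) \<le> \<theta> * q \<theta> - c (q \<theta>) above by a constant, so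
   the first summand is finite when f is a probability density. *)
definition profit ::
  "real \<Rightarrow> real \<Rightarrow> (real \<Rightarrow> real) \<Rightarrow> (real \<Rightarrow> real) \<Rightarrow> (real \<Rightarrow> real) \<Rightarrow> (real \<Rightarrow> real) \<Rightarrow> ereal" where
  "profit lo hi f c q t =
     enn2ereal (\<integral>\<^sup>+\<theta>. ennreal ((t \<theta> - c (q \<theta>)) * f \<theta>) \<partial>lebesgue_on {lo..hi}) -
     enn2ereal (\<integral>\<^sup>+\<theta>. ennreal (- ((t \<theta> - c (q \<theta>)) * f \<theta>)) \<partial>lebesgue_on {lo..hi})"

definition optimal ::
  "real \<Rightarrow> real \<Rightarrow> (real \<Rightarrow> real) \<Rightarrow> (real \<Rightarrow> real) \<Rightarrow> (real \<Rightarrow> real) \<Rightarrow>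
   (real \<Rightarrow> real) \<Rightarrow> (real \<Rightarrow> real) \<Rightarrow> bool" where
  "optimal lo hi l f c q t \<longleftrightarrow>
     feasible lo hi l q t \<and>
     (\<forall>q' t'. feasible lo hi l q' t' \<longrightarrow> profit lo hi f c q' t' \<le> profit lo hi f c q t)"

end

theory Submission imports Defs begin

text \<open>
Rescale the rent by \<open>E x = exp (\<integral>\<^sub>l\<^sub>o\<^sup>x l)\<close>, so that the authentication rate from \<open>x\<close> to a
larger type \<open>y\<close> is \<open>E x / E y\<close>. Upward incentive constraints then say that the rescaled rent grows by
at least \<open>(y - x) * E x * q x\<close>, hence is at least the integral of \<open>E * q\<close>. Inserting this lower bound
into the profit and exchanging the order of integration turns the profit into the expectation of
\<open>\<phi> x * q x - c (q x)\<close>, which is maximised pointwise. Monotonicity of the virtual value makes the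
maximiser monotone, and this makes all incentive constraints hold.
\<close>

section \<open>Universal, Borel and Lebesgue measurability on the type interval\<close>

text \<open>Universal measurability is applied to Lebesgue measure on the interval, which is finite
  there. A set in the completion of the restriction is a Borel set up to part of a null set, hence
  lies in \<open>lebesgue_on\<close>.\<close>

lemma borel_measurable_lebesgue_on_if_universally:
  assumes "universally_measurable_on {a..b} g"
  shows "g \<in> borel_measurable (lebesgue_on {a..b})"
proof -
  let ?M = "restrict_space lborel {a..b}"
  have "finite_measure ?M"
    by (rule finite_measureI) (simp add: emeasure_restrict_space space_restrict_space emeasure_lborel_Icc_eq)
  moreover have "sets ?M = sets (restrict_space borel {a..b})"
    by (simp add: sets_restrict_space)
  ultimately have g: "g \<in> borel_measurable (completion ?M)"
    using assms unfolding universally_measurable_on_def by blast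
  have "sets (completion ?M) \<subseteq> sets (lebesgue_on {a..b})"
  proof
    fix A assume "A \<in> sets (completion ?M)"
    then obtain S N N' where A: "A = S \<union> N" "N \<subseteq> N'" "N' \<in> null_sets ?M" "S \<in> sets ?M"
      by (rule sets_completionE)
    have "N' \<in> null_sets lborel" "N' \<subseteq> {a..b}" "S \<in> sets lborel" "S \<subseteq> {a..b}"
      using A by (auto simp: null_sets_restrict_space sets_restrict_space)
    then show "A \<in> sets (lebesgue_on {a..b})"
      using A sets_completionI[of A S N N' lborel] by (auto simp: sets_restrict_space_iff)
  qed
  then show ?thesis
    using g by (intro borel_measurable_subalgebra[of "completion ?M" "lebesgue_on {a..b}"])
      (auto simp: space_restrict_space)
qed

lemma universally_measurable_if_borel:
  assumes "g \<in> borel_measurable (restrict_space borel S)"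
  shows "universally_measurable_on S g"
  unfolding universally_measurable_on_def
proof (intro allI impI)
  fix M :: "real measure" assume "finite_measure M \<and> sets M = sets (restrict_space borel S)"
  then have "borel_measurable M = (borel_measurable (restrict_space borel S) :: (real \<Rightarrow> real) set)"
    by (intro measurable_cong_sets) auto
  then show "g \<in> borel_measurable (completion M)"
    using assms by (intro measurable_completion) simp
qed

lemma borel_measurable_lebesgue_on_if_borel:
  fixes g :: "real \<Rightarrow> real"
  assumes "g \<in> borel_measurable (restrict_space borel {a..b})"
  shows "g \<in> borel_measurable (lebesgue_on {a..b})"
  using assms by (intro borel_measurable_lebesgue_on_if_universally universally_measurable_if_borel)

section \<open>Integrating a lower bound for increments\<close>

text \<open>
Differentiability of monotone functions is avoided: on \<open>{a..b - d}\<close>, \<open>g\<close> is below the difference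
quotient of \<open>V\<close> with step \<open>d\<close>, whose integral telescopes to averages of \<open>V\<close> near \<open>b\<close> and \<open>a\<close>.
\<close>
lemma nn_integral_le_if_increments_ge:
  fixes V g :: "real \<Rightarrow> real"
  assumes "a \<le> b"
    and meas: "g \<in> borel_measurable (lebesgue_on {a..b})"
    and nonneg: "\<And>x. x \<in> {a..b} \<Longrightarrow> 0 \<le> g x"
    and incr: "\<And>x y. a \<le> x \<Longrightarrow> x \<le> y \<Longrightarrow> y \<le> b \<Longrightarrow> V x + (y - x) * g x \<le> V y"
  shows "(\<integral>\<^sup>+x. ennreal (g x) \<partial>lebesgue_on {a..b}) \<le> ennreal (V b - V a)"
proof (cases "a = b")
  case True
  then show ?thesis
    by (simp add: nn_integral_restrict_space nn_integral_completion)
next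
  case False
  with assms have "a < b" by simp
  have mono: "V x \<le> V y" if "a \<le> x" "x \<le> y" "y \<le> b" for x y
  proof -
    have "0 \<le> (y - x) * g x" using that nonneg by auto
    then show ?thesis using incr[OF that] by linarith
  qed
  \<comment> \<open>Stopping at \<open>c < b\<close> leaves room for a step of length
    \<open>d = b - c\<close> inside the interval; afterwards \<open>c\<close> tends to
    \<open>b\<close>.\<close>
  have part: "(\<integral>\<^sup>+x. ennreal (g x) \<partial>lebesgue_on {a..c}) \<le> ennreal (V b - V a)"
    if c: "a \<le> c" "c < b" for c
  proof -
    define d where "d = b - c"
    have d: "0 < d" using c by (simp add: d_def)
    have bd: "b = c + d" by (simp add: d_def)
    let ?D = "\<lambda>x. (V (x + d) - V x) / d"
    have mV: "mono_on {a..c} V" "mono_on {a..c} (\<lambda>x. V (x + d))"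
      using d by (auto intro!: mono_onI mono simp: bd)
    have VI: "V integrable_on {a'..b'}" if "a \<le> a'" "b' \<le> b" for a' b'
      using that by (intro integrable_on_mono_on mono_onI mono) auto
    have iD: "integrable (lebesgue_on {a..c}) ?D"
      by (intro integrable_divide_zero Bochner_Integration.integrable_diff integrable_mono_on mV)
    have gD: "g x \<le> ?D x" if "x \<in> {a..c}" for x
      using incr[of x "x + d"] that d by (auto simp: bd field_simps)
    have "(\<integral>\<^sup>+x. ennreal (g x) \<partial>lebesgue_on {a..c}) \<le> (\<integral>\<^sup>+x. ennreal (?D x) \<partial>lebesgue_on {a..c})"
      using gD by (intro nn_integral_mono ennreal_leI) auto
    also have "\<dots> = ennreal (integral\<^sup>L (lebesgue_on {a..c}) ?D)"
    proof (rule nn_integral_eq_integral[OF iD])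
      have "0 \<le> ?D x" if "x \<in> {a..c}" for x
        using gD[OF that] nonneg[of x] that c by auto
      then show "AE x in lebesgue_on {a..c}. 0 \<le> ?D x"
        by (intro AE_I2) auto
    qed
    also have "integral\<^sup>L (lebesgue_on {a..c}) ?D = integral {a..c} ?D"
      by (rule integral_unique[OF has_integral_integral_lebesgue_on[OF iD], symmetric]) simp
    also have "\<dots> = (integral {a..c} (\<lambda>x. V (x + d)) - integral {a..c} V) / d"
      using mV by (subst integral_divide) (simp add: Henstock_Kurzweil_Integration.integral_diff integrable_on_mono_on)
    also have "integral {a..c} (\<lambda>x. V (x + d)) = integral {a + d..b} V"
    proof -
      have "(V has_integral integral {a+d..b} V) (cbox (a + d) (c + d))"
        using VI[of "a+d" b] d by (simp add: bd integrable_integral)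
      from has_integral_affinity[OF this, of 1 d] have "((\<lambda>x. V (x + d)) has_integral integral {a + d..b} V) {a..c}"
        using c by (simp add: algebra_simps)
      then show ?thesis by (rule integral_unique)
    qed
    \<comment> \<open>The step \<open>d\<close> may exceed \<open>c - a\<close>, so both sides are
      compared through the integral over \<open>{a..b}\<close> instead of cancelling a common middle
      piece.\<close>
    also have "integral {a + d..b} V - integral {a..c} V
        = integral {c..b} V - integral {a..a + d} V"
    proof -
      have "integral {a..c} V + integral {c..b} V = integral {a..b} V"
        using c VI by (intro Henstock_Kurzweil_Integration.integral_combine) auto
      moreover have "integral {a..a+d} V + integral {a+d..b} V = integral {a..b} V"
        using c d VI by (intro Henstock_Kurzweil_Integration.integral_combine) (auto simp: bd)
      ultimately show ?thesis by simp
    qed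
    \<comment> \<open>Both remaining intervals have length \<open>d\<close>; monotonicity bounds
      \<open>V\<close> by \<open>V b\<close> on the right one and from below by \<open>V a\<close>
      on the left one.\<close>
    also have "(integral {c..b} V - integral {a..a + d} V) / d \<le> V b - V a"
    proof -
      have "integral {c..b} V \<le> integral {c..b} (\<lambda>x. V b)"
        using c VI by (intro integral_le) (auto intro: mono)
      moreover have "integral {a..a + d} (\<lambda>x. V a) \<le> integral {a..a + d} V"
        using c d VI by (intro integral_le) (auto simp: bd intro: mono)
      ultimately have "integral {c..b} V - integral {a..a + d} V \<le> (V b - V a) * d"
        using d by (simp add: bd algebra_simps)
      then show ?thesis using d by (simp add: field_simps)
    qed
    finally show ?thesis by (simp add: ennreal_leI)
  qed
  let ?N = "lebesgue_on {a..b}"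
  \<comment> \<open>With \<open>g\<close> as a density, the passage to the limit is continuity of a
    measure from below along \<open>C\<close>. Since \<open>C 0\<close> is the single point
    \<open>a\<close>, every right endpoint lies in \<open>{a..<b}\<close>, as \<open>part\<close>
    demands.\<close>
  define \<mu> where "\<mu> = density ?N (\<lambda>x. ennreal (g x))"
  define C where "C n = {a..b - (b - a) / real (Suc n)}" for n
  have Csub: "C n \<subseteq> {a..b}" for n
  proof -
    have "0 \<le> (b - a) / real (Suc n)" using \<open>a < b\<close> by simp
    then show ?thesis by (auto simp: C_def simp del: of_nat_Suc)
  qed
  have Cs: "C n \<in> sets ?N" for n
    using Csub[of n] by (auto simp: sets_restrict_space_iff C_def)
  have C_le: "emeasure \<mu> (C n) \<le> ennreal (V b - V a)" for n
  proof -
    have "emeasure \<mu> (C n) = (\<integral>\<^sup>+x. ennreal (g x) * indicator (C n) x \<partial>?N)"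
      unfolding \<mu>_def using meas Cs by (intro emeasure_density) auto
    also have "\<dots> = (\<integral>\<^sup>+x. ennreal (g x) \<partial>restrict_space ?N (C n))"
      using Cs[of n] Csub[of n] by (subst nn_integral_restrict_space) (auto simp: Int_absorb2)
    also have "restrict_space ?N (C n) = lebesgue_on (C n)"
      using Csub[of n] by (subst restrict_restrict_space) (auto simp: Int_absorb1 C_def)
    also have "(\<integral>\<^sup>+x. ennreal (g x) \<partial>lebesgue_on (C n)) \<le> ennreal (V b - V a)"
    proof -
      have "(b - a) / real (Suc n) \<le> b - a" "0 < (b - a) / real (Suc n)"
        using \<open>a < b\<close> by (auto simp: divide_le_eq mult_le_cancel_left1 simp del: of_nat_Suc)
      then have "a \<le> b - (b - a) / real (Suc n)" "b - (b - a) / real (Suc n) < b" by linarith+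
      then show ?thesis unfolding C_def by (rule part)
    qed
    finally show ?thesis .
  qed
  have "incseq C"
  proof (rule incseq_SucI)
    fix n
    have "(b - a) / real (Suc (Suc n)) \<le> (b - a) / real (Suc n)"
      using \<open>a < b\<close> by (intro divide_left_mono) auto
    then show "C n \<subseteq> C (Suc n)" unfolding C_def by (simp del: of_nat_Suc)
  qed
  then have "(SUP n. emeasure \<mu> (C n)) = emeasure \<mu> (\<Union>n. C n)"
    using Cs by (intro SUP_emeasure_incseq) (auto simp: \<mu>_def)
  moreover have UC: "(\<Union>n. C n) = {a..b} - {b}"
  proof -
    have up: "\<exists>n. x \<le> b - (b - a) / real (Suc n)" if x: "a \<le> x" "x < b" for x
    proof -
      obtain n where n: "(b - a) / (b - x) < real n" using reals_Archimedean2 by blast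
      then have "(b - a) < (b - x) * real n" using x by (simp add: field_simps)
      also have "\<dots> \<le> (b - x) * real (Suc n)" using x by (intro mult_left_mono) auto
      finally have "(b - a) / real (Suc n) \<le> b - x" by (simp add: field_simps)
      then show ?thesis by (intro exI[of _ n]) linarith
    qed
    have down: "x < b" if "x \<le> b - (b - a) / real (Suc n)" for x n
    proof -
      have "0 < (b - a) / real (Suc n)" using \<open>a < b\<close> by simp
      then show ?thesis using that by linarith
    qed
    show ?thesis
    proof (intro set_eqI iffI)
      fix x assume "x \<in> (\<Union>n. C n)"
      then obtain n where "a \<le> x" "x \<le> b - (b - a) / real (Suc n)"
        unfolding C_def by (auto simp del: of_nat_Suc)
      with down[of x n] show "x \<in> {a..b} - {b}" by auto
    next
      fix x assume "x \<in> {a..b} - {b}"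
      then have x: "a \<le> x" "x < b" by auto
      from up[OF this] obtain n where "x \<le> b - (b - a) / real (Suc n)" by blast
      with x have "x \<in> C n" unfolding C_def by (simp del: of_nat_Suc)
      then show "x \<in> (\<Union>n. C n)" by blast
    qed
  qed
  ultimately have le: "emeasure \<mu> ({a..b} - {b}) \<le> ennreal (V b - V a)"
    using SUP_least[of UNIV "\<lambda>n. emeasure \<mu> (C n)"] C_le by auto
  \<comment> \<open>The sets \<open>C n\<close> exhaust everything but \<open>b\<close>, and a
    single point is null.\<close>
  have "(\<integral>\<^sup>+x. ennreal (g x) \<partial>?N) = (\<integral>\<^sup>+x. ennreal (g x) * indicator ({a..b} - {b}) x \<partial>?N)"
  proof (rule nn_integral_cong_AE)
    have "AE x in lebesgue. x \<noteq> b"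
      by (rule AE_completion) (rule AE_lborel_singleton)
    then have "AE x in ?N. x \<noteq> b"
      by (subst AE_restrict_space_iff) auto
    then show "AE x in ?N. ennreal (g x) = ennreal (g x) * indicator ({a..b} - {b}) x"
      by (rule lebesgue_on_mono) auto
  qed
  also have "\<dots> = emeasure \<mu> ({a..b} - {b})"
    unfolding \<mu>_def using meas by (intro emeasure_density[symmetric]) (auto simp: sets_restrict_space_iff)
  finally show ?thesis using le by simp
qed

section \<open>Interval integrals and the factorisation of the authentication rate\<close>

text \<open>Puts integrals with varying limits on one fixed measure space, the limits becoming an
  indicator. This is the form in which Fubini applies.\<close>

lemma LBINT_eq_integral_lebesgue_on:
  fixes h :: "real \<Rightarrow> real"
  assumes "h \<in> borel_measurable (restrict_space borel {a..b})"
    and "a \<le> x" "x \<le> y" "y \<le> b"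
  shows "(LBINT \<xi>=ereal x..ereal y. h \<xi>) = (\<integral>\<xi>. h \<xi> * indicator {x..y} \<xi> \<partial>lebesgue_on {a..b})"
proof -
  \<comment> \<open>Measurability of \<open>h\<close> is known on \<open>{a..b}\<close> alone, so
    \<open>h\<close> is first extended by zero.\<close>
  have *: "(\<lambda>\<xi>. indicator {a..b} \<xi> *\<^sub>R h \<xi>) \<in> borel_measurable borel"
    by (subst borel_measurable_restrict_space_iff[symmetric]) (simp_all add: assms(1))
  have "(\<lambda>\<xi>. indicator {x..y} \<xi> * (indicator {a..b} \<xi> * h \<xi>)) \<in> borel_measurable borel"
    by (rule borel_measurable_times[OF _ *[unfolded real_scaleR_def]]) simp
  also have "(\<lambda>\<xi>. indicator {x..y} \<xi> * (indicator {a..b} \<xi> * h \<xi>)) = (\<lambda>\<xi>. indicator {x..y} \<xi> * h \<xi>)"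
    using assms by (auto simp: fun_eq_iff indicator_def)
  finally have meas: "(\<lambda>\<xi>. indicator {x..y} \<xi> * h \<xi>) \<in> borel_measurable lborel"
    by simp
  have "(LBINT \<xi>=ereal x..ereal y. h \<xi>) = (\<integral>\<xi>. indicator {x..y} \<xi> * h \<xi> \<partial>lborel)"
    using assms by (simp add: interval_integral_Icc set_lebesgue_integral_def)
  also have "\<dots> = (\<integral>\<xi>. indicator {x..y} \<xi> * h \<xi> \<partial>lebesgue)"
    using meas by (rule integral_completion[symmetric])
  also have "\<dots> = (\<integral>\<xi>. indicator {a..b} \<xi> *\<^sub>R (h \<xi> * indicator {x..y} \<xi>) \<partial>lebesgue)"
    using assms by (intro Bochner_Integration.integral_cong) (auto simp: indicator_def)
  also have "\<dots> = (\<integral>\<xi>. h \<xi> * indicator {x..y} \<xi> \<partial>lebesgue_on {a..b})"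
    by (rule integral_restrict_space[symmetric]) auto
  finally show ?thesis .
qed

text \<open>Since \<open>l\<close> is nonnegative, the absolute value merely fixes the orientation,
  and the integral over \<open>{x..y}\<close> is a difference of two integrals starting at
  \<open>a\<close>.\<close>

lemma auth_rate_eq:
  assumes "continuous_on {a..b} l" "\<And>\<theta>. \<theta> \<in> {a..b} \<Longrightarrow> 0 \<le> l \<theta>"
    and "a \<le> x" "x \<le> y" "y \<le> b"
  shows "auth_rate l x y = exp (integral {a..x} l) / exp (integral {a..y} l)"
    and "auth_rate l y x = exp (integral {a..x} l) / exp (integral {a..y} l)"
proof -
  have cont: "continuous_on {x..y} l"
    using assms by (auto intro: continuous_on_subset)
  then have "(LBINT \<xi>=ereal x..ereal y. l \<xi>) = integral {x..y} l"
    using assms by (intro interval_integral_eq_integral borel_integrable_atLeastAtMost') auto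
  moreover have "integral {a..x} l + integral {x..y} l = integral {a..y} l"
    using assms by (intro Henstock_Kurzweil_Integration.integral_combine integrable_continuous_real)
      (auto intro: continuous_on_subset)
  moreover have "0 \<le> integral {x..y} l"
    using assms cont by (intro integral_nonneg integrable_continuous_real) auto
  ultimately show "auth_rate l x y = exp (integral {a..x} l) / exp (integral {a..y} l)"
    by (simp add: auth_rate_def flip: exp_diff)
  moreover have "auth_rate l y x = auth_rate l x y"
    unfolding auth_rate_def by (subst interval_integral_endpoints_reverse) simp
  ultimately show "auth_rate l y x = exp (integral {a..x} l) / exp (integral {a..y} l)"
    by simp
qed

lemma mono_on_exp_integral:
  fixes l :: "real \<Rightarrow> real"
  assumes "continuous_on {a..b} l" "\<And>\<theta>. \<theta> \<in> {a..b} \<Longrightarrow> 0 \<le> l \<theta>"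
  shows "mono_on {a..b} (\<lambda>x. exp (integral {a..x} l))"
proof (rule mono_onI)
  fix x y assume xy: "x \<in> {a..b}" "y \<in> {a..b}" "x \<le> y"
  have "integral {a..x} l \<le> integral {a..y} l"
    using xy assms by (intro integral_subset_le integrable_continuous_real) (auto intro: continuous_on_subset)
  then show "exp (integral {a..x} l) \<le> exp (integral {a..y} l)" by simp
qed

section \<open>Convex cost and marginal cost\<close>

text \<open>By the mean value theorem the slope of \<open>c\<close> between \<open>x\<close> and
  \<open>z\<close> is \<open>c' w\<close> for some \<open>w\<close> strictly between them, so strict
  monotonicity compares it with \<open>c' x\<close>. The strictness later yields uniqueness of the
  quantity.\<close>

lemma strict_minimum_if_deriv_strict_mono:
  fixes c c' :: "real \<Rightarrow> real"
  assumes deriv: "\<And>x. 0 \<le> x \<Longrightarrow> (c has_real_derivative c' x) (at x within {0..})"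
    and strict: "strict_mono_on {0..} c'"
    and "0 \<le> x" "0 \<le> z" "z \<noteq> x"
  shows "c' x * z - c z < c' x * x - c x"
proof -
  have cont: "continuous_on {u..v} c" if "0 \<le> u" for u v
    using that deriv by (intro continuous_on_subset[OF DERIV_continuous_on, of "{0..}"]) auto
  \<comment> \<open>At interior points the derivative within \<open>{0..}\<close> is two-sided; at 0
    the mean value theorem asks for continuity only.\<close>
  have D: "DERIV c w :> c' w" if "0 < w" for w
    using DERIV_subset[OF deriv[of w], of "{0..w + 1}"] that by (auto simp: at_within_Icc_at)
  have mvt: "\<exists>w>u. w < v \<and> c v - c u = (v - u) * c' w" if "0 \<le> u" "u < v" for u v
  proof -
    have "\<exists>r w. u < w \<and> w < v \<and> DERIV c w :> r \<and> c v - c u = (v - u) * r"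
      using that by (intro MVT cont) (auto simp: real_differentiable_def intro!: exI[of _ "c' w" for w] D)
    then obtain r w where w: "u < w" "w < v" "DERIV c w :> r" "c v - c u = (v - u) * r" by blast
    have "r = c' w"
      using w that by (intro DERIV_unique[OF w(3) D]) linarith
    with w show ?thesis by blast
  qed
  show ?thesis
  proof (cases "x < z")
    case True
    obtain w where w: "x < w" "w < z" "c z - c x = (z - x) * c' w"
      using mvt[OF \<open>0 \<le> x\<close> True] by blast
    moreover have "c' x < c' w"
      using strict w assms by (auto simp: strict_mono_on_def)
    ultimately have "(z - x) * c' x < c z - c x"
      using True by simp
    then show ?thesis by (simp add: algebra_simps)
  next
    case False
    then have "z < x" using assms by simp
    obtain w where w: "z < w" "w < x" "c x - c z = (x - z) * c' w"
      using mvt[OF \<open>0 \<le> z\<close> \<open>z < x\<close>] by blast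
    moreover have "c' w < c' x"
      using strict w assms by (auto simp: strict_mono_on_def)
    ultimately have "c x - c z < (x - z) * c' x"
      using \<open>z < x\<close> by simp
    then show ?thesis by (simp add: algebra_simps)
  qed
qed

text \<open>Darboux's intermediate value property of derivatives: \<open>c'\<close> is not assumed
  continuous. A minimiser of \<open>c x - y * x\<close> on \<open>{0..M}\<close> is interior because
  the derivative is negative at 0 and positive at \<open>M\<close>, so the derivative vanishes
  there.\<close>

lemma exists_marginal_cost_eq:
  fixes c c' :: "real \<Rightarrow> real"
  assumes deriv: "\<And>x. 0 \<le> x \<Longrightarrow> (c has_real_derivative c' x) (at x within {0..})"
    and "c' 0 \<le> y" "y < c' M" "0 \<le> M"
  shows "\<exists>x\<in>{0..M}. c' x = y"
proof (cases "c' 0 = y")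
  case False
  with assms have y: "c' 0 < y" by simp
  then have "0 < M" using assms by (cases "M = 0") auto
  let ?k = "\<lambda>x. c x - y * x"
  have dk: "(?k has_real_derivative c' x - y) (at x within {0..M})" if "0 \<le> x" for x
    using DERIV_subset[OF deriv[OF that], of "{0..M}"] by (auto intro!: derivative_eq_intros)
  then have "continuous_on {0..M} ?k"
    by (intro DERIV_continuous_on) auto
  then obtain x where x: "x \<in> {0..M}" and min: "\<And>z. z \<in> {0..M} \<Longrightarrow> ?k x \<le> ?k z"
    using continuous_attains_inf[of "{0..M}" ?k] \<open>0 \<le> M\<close> by auto
  have "x \<noteq> 0"
  proof
    assume "x = 0"
    have "\<exists>d>0. \<forall>h>0. 0 + h \<in> {0..M} \<longrightarrow> h < d \<longrightarrow> ?k (0 + h) < ?k 0"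
      using dk[of 0] y by (intro has_real_derivative_neg_dec_right) auto
    then obtain d where "d > 0" and d: "\<And>h. 0 < h \<Longrightarrow> h \<le> M \<Longrightarrow> h < d \<Longrightarrow> ?k h < ?k 0" by auto
    \<comment> \<open>Half of \<open>d\<close> is strictly below \<open>d\<close>, and the cap
      \<open>M\<close> keeps the point in \<open>{0..M}\<close>.\<close>
    define e where "e = min (d / 2) M"
    have "0 < e" "e \<le> M" "e < d" using \<open>0 < d\<close> \<open>0 < M\<close> by (auto simp: e_def)
    with d[of e] min[of e] \<open>x = 0\<close> show False by simp
  qed
  moreover have "x \<noteq> M"
  proof
    assume "x = M"
    have "\<exists>d>0. \<forall>h>0. M - h \<in> {0..M} \<longrightarrow> h < d \<longrightarrow> ?k (M - h) < ?k M"
      using dk[of M] assms by (intro has_real_derivative_pos_inc_left) auto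
    then obtain d where "d > 0" and d: "\<And>h. 0 < h \<Longrightarrow> h \<le> M \<Longrightarrow> h < d \<Longrightarrow> ?k (M - h) < ?k M" by auto
    define e where "e = min (d / 2) M"
    have "0 < e" "e \<le> M" "e < d" using \<open>0 < d\<close> \<open>0 < M\<close> by (auto simp: e_def)
    with d[of e] min[of "M - e"] \<open>x = M\<close> show False by simp
  qed
  ultimately have int: "0 < x" "x < M" using x by auto
  have "DERIV ?k x :> c' x - y"
    using dk[of x] int by (simp add: at_within_Icc_at)
  moreover have "\<forall>z. \<bar>x - z\<bar> < min x (M - x) \<longrightarrow> ?k x \<le> ?k z"
    by (auto intro!: min)
  ultimately have "c' x - y = 0"
    using int DERIV_local_min[of ?k "c' x - y" x "min x (M - x)"] by simp
  then show ?thesis using x by auto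
qed (use assms in auto)

section \<open>Order of integration and integrals with value minus infinity\<close>

text \<open>Both sides integrate \<open>g y * h x\<close> over the triangle
  \<open>y \<le> x\<close>, and integrability follows from that of the product on the square. With
  \<open>g\<close> as \<open>E * q\<close> and \<open>h\<close> as \<open>f / E\<close>, this turns
  expected rents into a weight on the quantity.\<close>

lemma Fubini_triangle:
  fixes g h :: "real \<Rightarrow> real"
  assumes g: "integrable (lebesgue_on {a..b}) g" and h: "integrable (lebesgue_on {a..b}) h"
  defines "N \<equiv> lebesgue_on {a..b}"
  shows "integrable N (\<lambda>x. (\<integral>y. g y * indicator {a..x} y \<partial>N) * h x)"
    and "integrable N (\<lambda>y. g y * (\<integral>x. h x * indicator {y..b} x \<partial>N))"
    and "(\<integral>x. (\<integral>y. g y * indicator {a..x} y \<partial>N) * h x \<partial>N)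
        = (\<integral>y. g y * (\<integral>x. h x * indicator {y..b} x \<partial>N) \<partial>N)"
proof -
  interpret N: finite_measure N
    unfolding N_def by (rule finite_measure_lebesgue_on) auto
  interpret P: pair_sigma_finite N N ..
  have sp: "space N = {a..b}" by (simp add: N_def)
  have [measurable]: "g \<in> borel_measurable N" "h \<in> borel_measurable N"
    and gi: "integrable N g" and hi: "integrable N h"
    using g h by (auto simp: N_def)
  \<comment> \<open>Makes the triangle measurable in the product space.\<close>
  have id: "(\<lambda>x. x) \<in> borel_measurable N"
    using id_borel_measurable_lebesgue_on[of "{a..b}"] by (simp add: N_def id_def)
  have [measurable]: "(\<lambda>p. fst p) \<in> borel_measurable (N \<Otimes>\<^sub>M N)" "(\<lambda>p. snd p) \<in> borel_measurable (N \<Otimes>\<^sub>M N)"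
    using measurable_compose[OF measurable_fst id] measurable_compose[OF measurable_snd id] by auto
  define K where "K = (\<lambda>x y. g y * h x * (if y \<le> x then 1 else 0))"
  have K1: "K x y = g y * indicator {a..x} y * h x" if "y \<in> {a..b}" for x y
    using that by (auto simp: K_def indicator_def)
  have K2: "K x y = g y * (h x * indicator {y..b} x)" if "x \<in> {a..b}" for x y
    using that by (auto simp: K_def indicator_def)
  have [measurable]: "case_prod K \<in> borel_measurable (N \<Otimes>\<^sub>M N)"
    unfolding K_def case_prod_unfold by measurable
  have Ki: "integrable (N \<Otimes>\<^sub>M N) (case_prod K)"
  proof (rule Bochner_Integration.integrable_bound)
    show "integrable (N \<Otimes>\<^sub>M N) (\<lambda>(x, y). h x * g y)"
    proof (rule P.Fubini_integrable)
      show "integrable N (\<lambda>x. \<integral>y. norm (case (x, y) of (x, y) \<Rightarrow> h x * g y) \<partial>N)"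
        using gi hi by (simp add: abs_mult)
    qed (use gi in \<open>auto simp: case_prod_unfold\<close>)
  qed (auto simp: K_def abs_mult)
  have e1: "(\<integral>y. g y * indicator {a..x} y \<partial>N) * h x = (\<integral>y. K x y \<partial>N)" for x
    by (subst integral_mult_left_zero[symmetric]) (intro Bochner_Integration.integral_cong, auto simp: K1 sp)
  have e2: "g y * (\<integral>x. h x * indicator {y..b} x \<partial>N) = (\<integral>x. K x y \<partial>N)" for y
    by (subst integral_mult_right_zero[symmetric]) (intro Bochner_Integration.integral_cong, auto simp: K2 sp)
  show "integrable N (\<lambda>x. (\<integral>y. g y * indicator {a..x} y \<partial>N) * h x)"
    unfolding e1 using P.integrable_fst[OF Ki] by simp
  show "integrable N (\<lambda>y. g y * (\<integral>x. h x * indicator {y..b} x \<partial>N))"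
    unfolding e2 using P.integrable_snd[OF Ki] by simp
  show "(\<integral>x. (\<integral>y. g y * indicator {a..x} y \<partial>N) * h x \<partial>N)
        = (\<integral>y. g y * (\<integral>x. h x * indicator {y..b} x \<partial>N) \<partial>N)"
    unfolding e1 e2 using P.Fubini_integral[OF Ki] by simp
qed

lemma ereal_integral_eq_nn_integral_diff:
  fixes P :: "'a \<Rightarrow> real"
  assumes "integrable M P"
  shows "enn2ereal (\<integral>\<^sup>+x. ennreal (P x) \<partial>M) - enn2ereal (\<integral>\<^sup>+x. ennreal (- P x) \<partial>M)
    = ereal (\<integral>x. P x \<partial>M)"
proof -
  obtain r s where rs: "0 \<le> r" "0 \<le> s" "(\<integral>\<^sup>+x. ennreal (P x) \<partial>M) = ennreal r"
      "(\<integral>\<^sup>+x. ennreal (- P x) \<partial>M) = ennreal s" "(\<integral>x. P x \<partial>M) = r - s"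
    using assms by (rule integrableE)
  then show ?thesis by (simp add: enn2ereal_ennreal)
qed

text \<open>Domination by an integrable \<open>B\<close> makes the positive part of \<open>P\<close>
  finite, so \<open>P\<close> is integrable unless \<open>J\<close> is minus infinity. If
  \<open>J\<close> reaches the integral of \<open>B\<close>, then \<open>B - P\<close> is
  nonnegative almost everywhere with integral 0.\<close>

lemma nn_integral_diff_dominated:
  fixes P B :: "'a \<Rightarrow> real"
  assumes "P \<in> borel_measurable M" "integrable M B" "AE x in M. P x \<le> B x"
  defines "J \<equiv> enn2ereal (\<integral>\<^sup>+x. ennreal (P x) \<partial>M) - enn2ereal (\<integral>\<^sup>+x. ennreal (- P x) \<partial>M)"
  shows "J \<le> ereal (\<integral>x. B x \<partial>M)"
    and "ereal (\<integral>x. B x \<partial>M) \<le> J \<Longrightarrow> AE x in M. P x = B x"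
proof -
  have pos: "(\<integral>\<^sup>+x. ennreal (P x) \<partial>M) < \<infinity>"
  proof -
    have "(\<integral>\<^sup>+x. ennreal (P x) \<partial>M) \<le> (\<integral>\<^sup>+x. ennreal (B x) \<partial>M)"
      using assms(3) by (intro nn_integral_mono_AE) (auto elim: AE_mp intro: ennreal_leI)
    also have "\<dots> \<le> (\<integral>\<^sup>+x. ennreal (norm (B x)) \<partial>M)"
      by (intro nn_integral_mono ennreal_leI) simp
    also have "\<dots> < \<infinity>" using assms(2) by (simp add: integrable_iff_bounded)
    finally show ?thesis .
  qed
  have neg: "J = -\<infinity>" if "(\<integral>\<^sup>+x. ennreal (- P x) \<partial>M) = \<infinity>"
    using pos that unfolding J_def by (cases "(\<integral>\<^sup>+x. ennreal (P x) \<partial>M)") (auto simp: enn2ereal_ennreal)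
  have int: "integrable M P" if "(\<integral>\<^sup>+x. ennreal (- P x) \<partial>M) \<noteq> \<infinity>"
    using assms(1) pos that by (simp add: real_integrable_def)
  have le: "(\<integral>x. P x \<partial>M) \<le> (\<integral>x. B x \<partial>M)" if "integrable M P"
    using that assms by (intro integral_mono_AE)
  show "J \<le> ereal (\<integral>x. B x \<partial>M)"
    using neg int le ereal_integral_eq_nn_integral_diff[of M P] unfolding J_def
    by (cases "(\<integral>\<^sup>+x. ennreal (- P x) \<partial>M) = \<infinity>") auto
  assume ge: "ereal (\<integral>x. B x \<partial>M) \<le> J"
  then have iP: "integrable M P" using neg int by fastforce
  then have "(\<integral>x. B x \<partial>M) \<le> (\<integral>x. P x \<partial>M)"
    using ge ereal_integral_eq_nn_integral_diff[OF iP] unfolding J_def by simp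
  with le[OF iP] have "(\<integral>x. B x - P x \<partial>M) = 0"
    using iP assms(2) by simp
  then have "AE x in M. B x - P x = 0"
    using assms iP by (subst (asm) integral_nonneg_eq_0_iff_AE) auto
  then show "AE x in M. P x = B x" by (rule AE_mp) auto
qed

section \<open>The pricing problem and its candidate solution\<close>

text \<open>The limit condition on marginal cost enters as \<open>c'_exceeds\<close>, a quantity
  whose marginal cost is above \<open>hi\<close>.\<close>

locale verified_pricing =
  fixes lo hi :: real and l f c c' :: "real \<Rightarrow> real"
  assumes lo_nonneg: "0 \<le> lo"
    and lo_less_hi: "lo < hi"
    and l_continuous: "continuous_on {lo..hi} l"
    and l_nonneg: "\<And>\<theta>. \<theta> \<in> {lo..hi} \<Longrightarrow> 0 \<le> l \<theta>"
    and f_borel: "f \<in> borel_measurable (restrict_space borel {lo..hi})"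
    and f_pos: "\<And>\<theta>. \<theta> \<in> {lo..hi} \<Longrightarrow> 0 < f \<theta>"
    and prob: "prob_space (type_distribution lo hi f)"
    and c_deriv: "\<And>x. 0 \<le> x \<Longrightarrow> (c has_real_derivative c' x) (at x within {0..})"
    and c'_0: "c' 0 = 0"
    and c'_strict: "strict_mono_on {0..} c'"
    and c'_exceeds: "\<exists>M\<ge>0. hi < c' M"
    and regular: "mono_on {lo..hi} (virtual_value hi l f)"
begin

abbreviation N :: "real measure" where "N \<equiv> lebesgue_on {lo..hi}"

abbreviation \<phi> :: "real \<Rightarrow> real" where "\<phi> \<equiv> virtual_value hi l f"

definition E :: "real \<Rightarrow> real" where "E x = exp (integral {lo..x} l)"

text \<open>The rescaled minimal rent: \<open>accum q x / E x\<close> is the integral subtracted in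
  the transfer formula.\<close>

definition accum :: "(real \<Rightarrow> real) \<Rightarrow> real \<Rightarrow> real" where
  "accum q x = (\<integral>y. (E y * q y) * indicator {lo..x} y \<partial>N)"

text \<open>Dual to \<open>accum\<close> under Fubini; \<open>E y * tail y\<close> is the integral
  inside the virtual value.\<close>

definition tail :: "real \<Rightarrow> real" where
  "tail y = (\<integral>x. (f x / E x) * indicator {y..hi} x \<partial>N)"

definition qs :: "real \<Rightarrow> real" where "qs x = (SOME z. 0 \<le> z \<and> c' z = max (\<phi> x) 0)"

definition ts :: "real \<Rightarrow> real" where "ts x = x * qs x - accum qs x / E x"

text \<open>The maximum of \<open>\<phi> x * z - c z\<close> over nonnegative \<open>z\<close>, as
  \<open>surplus_ge\<close> confirms.\<close>

definition surplus :: "real \<Rightarrow> real" where "surplus x = \<phi> x * qs x - c (qs x)"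

section \<open>The rescaling factor and the virtual value\<close>

lemma E_pos [simp]: "0 < E x"
  by (simp add: E_def)

lemma E_nonzero [simp]: "E x \<noteq> 0"
  by (simp add: E_def)

lemma E_mono: "mono_on {lo..hi} E"
  using mono_on_exp_integral[OF l_continuous l_nonneg] by (simp add: E_def[abs_def])

lemma E_ge_1: "x \<in> {lo..hi} \<Longrightarrow> 1 \<le> E x"
  using mono_onD[OF E_mono, of lo x] by (simp add: E_def)

lemma auth_rate_E:
  assumes "lo \<le> x" "x \<le> y" "y \<le> hi"
  shows "auth_rate l x y = E x / E y" "auth_rate l y x = E x / E y"
  using auth_rate_eq[OF l_continuous l_nonneg] assms by (simp_all add: E_def)

lemma E_borel: "E \<in> borel_measurable (restrict_space borel {lo..hi})"
  by (rule borel_measurable_mono_on_fnc[OF E_mono])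

lemma measurable_N [measurable]: "E \<in> borel_measurable N" "f \<in> borel_measurable N" "\<phi> \<in> borel_measurable N"
  by (fact borel_measurable_lebesgue_on_if_borel[OF E_borel]
      borel_measurable_lebesgue_on_if_borel[OF f_borel]
      borel_measurable_lebesgue_on_if_borel[OF borel_measurable_mono_on_fnc[OF regular]])+

lemma integrable_f: "integrable N f"
proof (rule integrableI_nonneg)
  interpret P: prob_space "type_distribution lo hi f" by (rule prob)
  have "emeasure (type_distribution lo hi f) {lo..hi} = 1"
    using P.emeasure_space_1 by (simp add: type_distribution_def)
  moreover have "emeasure (type_distribution lo hi f) {lo..hi} = (\<integral>\<^sup>+x. ennreal (f x) * indicator {lo..hi} x \<partial>N)"
    unfolding type_distribution_def by (rule emeasure_density) auto
  moreover have "\<dots> = (\<integral>\<^sup>+x. ennreal (f x) \<partial>N)"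
    by (intro nn_integral_cong) auto
  ultimately show "(\<integral>\<^sup>+x. ennreal (f x) \<partial>N) < \<infinity>" by simp
  show "AE x in N. 0 \<le> f x" using f_pos by (intro AE_I2) (auto intro: less_imp_le)
qed simp

lemma integrable_f_div_E: "integrable N (\<lambda>x. f x / E x)"
proof (rule Bochner_Integration.integrable_bound[OF integrable_f])
  have "f x / E x \<le> f x" if "x \<in> {lo..hi}" for x
    using E_ge_1[OF that] f_pos[OF that] by (simp add: divide_le_eq mult_le_cancel_left1)
  then show "AE x in N. norm (f x / E x) \<le> norm (f x)"
    using f_pos by (intro AE_I2) (auto simp: less_imp_le)
qed simp

text \<open>Above \<open>y\<close> the authentication rate is \<open>E y / E \<xi>\<close>, so
  \<open>E y\<close> leaves the integral and \<open>tail y\<close> remains.\<close>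

lemma virtual_value_times_f:
  assumes "y \<in> {lo..hi}"
  shows "\<phi> y * f y = y * f y - E y * tail y"
proof -
  have "(LBINT \<xi>=ereal y..ereal hi. auth_rate l y \<xi> * f \<xi>) = (LBINT \<xi>=ereal y..ereal hi. E y * (f \<xi> / E \<xi>))"
    using assms by (intro interval_integral_cong) (auto simp: auth_rate_E)
  also have "\<dots> = (\<integral>\<xi>. E y * (f \<xi> / E \<xi>) * indicator {y..hi} \<xi> \<partial>N)"
    using assms E_borel f_borel by (intro LBINT_eq_integral_lebesgue_on) auto
  also have "\<dots> = E y * tail y"
    unfolding tail_def by (subst integral_mult_right_zero[symmetric]) (simp add: mult.assoc)
  finally show ?thesis
    using f_pos[OF assms] by (simp add: virtual_value_def algebra_simps)
qed

lemma LBINT_auth_rate_eq_accum: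
  assumes "x \<in> {lo..hi}" "q \<in> borel_measurable (restrict_space borel {lo..hi})"
  shows "(LBINT \<xi>=ereal lo..ereal x. auth_rate l \<xi> x * q \<xi>) = accum q x / E x"
proof -
  have "(LBINT \<xi>=ereal lo..ereal x. auth_rate l \<xi> x * q \<xi>) = (LBINT \<xi>=ereal lo..ereal x. E \<xi> * q \<xi> / E x)"
    using assms by (intro interval_integral_cong) (auto simp: auth_rate_E)
  also have "\<dots> = (\<integral>\<xi>. (E \<xi> * q \<xi> / E x) * indicator {lo..x} \<xi> \<partial>N)"
    using assms E_borel by (intro LBINT_eq_integral_lebesgue_on) auto
  also have "\<dots> = accum q x / E x"
    unfolding accum_def by (subst integral_divide_zero[symmetric]) simp
  finally show ?thesis .
qed

text \<open>The subtracted integral is nonnegative. The bound keeps the virtual value within the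
  range reached by marginal cost.\<close>

lemma virtual_value_le:
  assumes "x \<in> {lo..hi}"
  shows "\<phi> x \<le> hi"
proof -
  have "0 \<le> tail x"
    unfolding tail_def using f_pos by (intro integral_nonneg_AE AE_I2) (auto simp: indicator_def less_imp_le)
  then have "\<phi> x * f x \<le> x * f x"
    using virtual_value_times_f[OF assms] by (simp add: less_imp_le)
  then show ?thesis using f_pos[OF assms] assms by (simp add: mult_le_cancel_right)
qed

section \<open>Pointwise maximisation of the virtual surplus\<close>

lemma qs:
  assumes "x \<in> {lo..hi}"
  shows qs_nonneg: "0 \<le> qs x" and c'_qs: "c' (qs x) = max (\<phi> x) 0"
proof -
  obtain M where M: "0 \<le> M" "hi < c' M" using c'_exceeds by blast
  have "\<exists>z\<in>{0..M}. c' z = max (\<phi> x) 0"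
    using M c'_0 virtual_value_le[OF assms] lo_nonneg lo_less_hi by (intro exists_marginal_cost_eq[OF c_deriv]) auto
  then have "\<exists>z. 0 \<le> z \<and> c' z = max (\<phi> x) 0" by auto
  from someI_ex[OF this] show "0 \<le> qs x" "c' (qs x) = max (\<phi> x) 0"
    by (auto simp: qs_def)
qed

lemma c'_less_iff: "0 \<le> x \<Longrightarrow> 0 \<le> y \<Longrightarrow> c' x < c' y \<longleftrightarrow> x < y"
  using c'_strict by (auto simp: strict_mono_on_less)

text \<open>Regularity makes the marginal cost at \<open>qs\<close> increasing, and a strictly
  increasing \<open>c'\<close> reflects the order. Incentive compatibility of the candidate rests on
  this.\<close>

lemma qs_mono: "mono_on {lo..hi} qs"
proof (rule mono_onI)
  fix x y assume xy: "x \<in> {lo..hi}" "y \<in> {lo..hi}" "x \<le> y"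
  then have "\<not> c' (qs y) < c' (qs x)"
    using mono_onD[OF regular xy] by (auto simp: c'_qs)
  then show "qs x \<le> qs y" using xy by (simp add: c'_less_iff qs_nonneg)
qed

lemma qs_borel: "qs \<in> borel_measurable (restrict_space borel {lo..hi})"
  by (rule borel_measurable_mono_on_fnc[OF qs_mono])

lemma surplus_greater:
  assumes "x \<in> {lo..hi}" "0 \<le> z" "z \<noteq> qs x"
  shows "\<phi> x * z - c z < surplus x"
proof -
  have "\<phi> x * z \<le> c' (qs x) * z"
    using assms by (intro mult_right_mono) (simp_all add: c'_qs)
  moreover have "c' (qs x) * z - c z < c' (qs x) * qs x - c (qs x)"
    using assms by (intro strict_minimum_if_deriv_strict_mono c_deriv c'_strict) (auto simp: qs_nonneg)
  \<comment> \<open>Complementary slackness: where the virtual value is negative, the quantity is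
    0.\<close>
  moreover have "c' (qs x) * qs x = \<phi> x * qs x"
  proof (cases "\<phi> x < 0")
    case True
    then have "c' (qs x) = 0" using assms by (simp add: c'_qs)
    then have "qs x = 0" using c'_less_iff[of 0 "qs x"] qs_nonneg[OF assms(1)] c'_0 by simp
    then show ?thesis by simp
  qed (use assms in \<open>simp add: c'_qs\<close>)
  ultimately show ?thesis unfolding surplus_def by linarith
qed

lemma surplus_ge: "x \<in> {lo..hi} \<Longrightarrow> 0 \<le> z \<Longrightarrow> \<phi> x * z - c z \<le> surplus x"
  using surplus_greater[of x z] by (cases "z = qs x") (auto simp: surplus_def)

text \<open>Keeping the quantity \<open>qs x\<close> at a larger type \<open>y\<close> shows that
  \<open>surplus\<close> increases. Hence it is bounded by its end values, while \<open>f\<close> is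
  integrable.\<close>

lemma integrable_surplus_f: "integrable N (\<lambda>x. surplus x * f x)"
proof -
  have mono: "mono_on {lo..hi} surplus"
  proof (rule mono_onI)
    fix x y assume xy: "x \<in> {lo..hi}" "y \<in> {lo..hi}" "x \<le> y"
    then have "surplus x \<le> \<phi> y * qs x - c (qs x)"
      using mono_onD[OF regular xy] by (simp add: surplus_def mult_right_mono qs_nonneg)
    also have "\<dots> \<le> surplus y" using xy by (intro surplus_ge) (auto simp: qs_nonneg)
    finally show "surplus x \<le> surplus y" .
  qed
  then have [measurable]: "surplus \<in> borel_measurable N"
    by (intro borel_measurable_lebesgue_on_if_borel borel_measurable_mono_on_fnc)
  define C where "C = \<bar>surplus lo\<bar> + \<bar>surplus hi\<bar>"
  have "\<bar>surplus x\<bar> \<le> C" if "x \<in> {lo..hi}" for x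
    using mono_onD[OF mono, of lo x] mono_onD[OF mono, of x hi] that by (auto simp: C_def)
  then have "\<bar>surplus x * f x\<bar> \<le> \<bar>C * f x\<bar>" if "x \<in> {lo..hi}" for x
    using that unfolding abs_mult by (intro mult_right_mono) (auto intro: order_trans[OF _ abs_ge_self])
  then have "AE x in N. norm (surplus x * f x) \<le> norm (C * f x)"
    by (intro AE_I2) simp
  moreover have "integrable N (\<lambda>x. C * f x)"
    using integrable_f by simp
  ultimately show ?thesis
    by (rule Bochner_Integration.integrable_bound[rotated 2]) measurable
qed

section \<open>The lower bound on rents in any feasible mechanism\<close>

text \<open>Constraints against imitating smaller types bound the increments of \<open>E\<close>
  times the rent from below. Integrating them gives the bound on \<open>accum\<close>, and at
  \<open>hi\<close> also the integrability of \<open>E * q\<close>.\<close>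

lemma feasible_imp_accum_le:
  assumes "feasible lo hi l q t"
  shows "integrable N (\<lambda>y. E y * q y)"
    and "\<And>x. x \<in> {lo..hi} \<Longrightarrow> accum q x / E x \<le> x * q x - t x"
proof -
  let ?U = "\<lambda>x. x * q x - t x" and ?g = "\<lambda>y. E y * q y"
  have [measurable]: "q \<in> borel_measurable N" and q0: "\<And>x. x \<in> {lo..hi} \<Longrightarrow> 0 \<le> q x"
    and U0: "\<And>x. x \<in> {lo..hi} \<Longrightarrow> 0 \<le> ?U x"
    using assms by (auto simp: feasible_def mechanism_def borel_measurable_lebesgue_on_if_universally)
  have g0: "0 \<le> ?g x" if "x \<in> {lo..hi}" for x
    using q0[OF that] by (simp add: less_imp_le)
  \<comment> \<open>Type \<open>y\<close> imitates \<open>x\<close>; the constraint is multiplied by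
    \<open>E y\<close>, and the imitation payoff is the rent of \<open>x\<close> plus
    \<open>(y - x) * q x\<close>.\<close>
  have incr: "E x * ?U x + (y - x) * ?g x \<le> E y * ?U y" if "lo \<le> x" "x \<le> y" "y \<le> hi" for x y
  proof -
    have "auth_rate l x y * (y * q x - t x) \<le> ?U y"
      using assms that by (auto simp: feasible_def)
    then have "E x * (y * q x - t x) / E y \<le> ?U y"
      using that by (simp add: auth_rate_E)
    then have "E x * (y * q x - t x) \<le> E y * ?U y"
      by (subst (asm) divide_le_eq) (simp add: mult.commute)
    then show ?thesis by (simp add: algebra_simps)
  qed
  have le: "(\<integral>\<^sup>+y. ennreal (?g y * indicator {lo..x} y) \<partial>N) \<le> ennreal (E x * ?U x)"
    if x: "x \<in> {lo..hi}" for x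
  proof -
    have "(\<integral>\<^sup>+y. ennreal (?g y * indicator {lo..x} y) \<partial>N) = (\<integral>\<^sup>+y. ennreal (?g y) * indicator {lo..x} y \<partial>N)"
      by (intro nn_integral_cong) (auto simp: indicator_def)
    also have "\<dots> = (\<integral>\<^sup>+y. ennreal (?g y) \<partial>restrict_space N {lo..x})"
      using x by (subst nn_integral_restrict_space) (auto simp: Int_absorb2 sets_restrict_space_iff)
    also have rs: "restrict_space N {lo..x} = lebesgue_on {lo..x}"
      using x by (subst restrict_restrict_space) (auto simp: Int_absorb1)
    also have "(\<integral>\<^sup>+y. ennreal (?g y) \<partial>lebesgue_on {lo..x}) \<le> ennreal (E x * ?U x - E lo * ?U lo)"
    proof (rule nn_integral_le_if_increments_ge)
      have "?g \<in> borel_measurable (restrict_space N {lo..x})"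
        by (rule measurable_restrict_space1) simp
      then show "?g \<in> borel_measurable (lebesgue_on {lo..x})" by (simp only: rs)
    qed (use x g0 incr in auto)
    \<comment> \<open>Participation of the lowest type allows its rent to be dropped.\<close>
    also have "\<dots> \<le> ennreal (E x * ?U x)"
      using U0[of lo] lo_less_hi by (intro ennreal_leI) (simp add: less_imp_le)
    finally show ?thesis .
  qed
  show int: "integrable N ?g"
  proof (rule integrableI_nonneg)
    have "(\<integral>\<^sup>+y. ennreal (?g y) \<partial>N) = (\<integral>\<^sup>+y. ennreal (?g y * indicator {lo..hi} y) \<partial>N)"
      by (intro nn_integral_cong) auto
    also have "\<dots> < \<infinity>" using le[of hi] lo_less_hi by (auto simp: le_less_trans)
    finally show "(\<integral>\<^sup>+y. ennreal (?g y) \<partial>N) < \<infinity>" .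
  qed (use g0 in auto)
  fix x assume x: "x \<in> {lo..hi}"
  have "ennreal (accum q x) = (\<integral>\<^sup>+y. ennreal (?g y * indicator {lo..x} y) \<partial>N)"
    unfolding accum_def using x g0
    by (intro nn_integral_eq_integral[symmetric] integrable_real_mult_indicator int AE_I2)
       (auto simp: sets_restrict_space_iff)
  also note le[OF x]
  finally have "accum q x \<le> E x * ?U x"
    using U0[OF x] by (subst (asm) ennreal_le_iff) (auto simp: less_imp_le)
  then show "accum q x / E x \<le> ?U x" by (simp add: field_simps)
qed

section \<open>Feasibility of the candidate\<close>

lemma E_qs_mono: "mono_on {lo..hi} (\<lambda>y. E y * qs y)"
  using mono_onD[OF E_mono] mono_onD[OF qs_mono]
  by (intro mono_onI mult_mono) (auto simp: qs_nonneg less_imp_le)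

lemma integrable_E_qs: "integrable N (\<lambda>y. E y * qs y)"
  by (rule integrable_mono_on[OF E_qs_mono])

text \<open>The integrand increases, so its integral over \<open>{x..y}\<close> lies between the
  length times either end value. The lower bound deters imitation of smaller types, the upper bound
  that of larger ones.\<close>

lemma accum_qs_bounds:
  assumes "lo \<le> x" "x \<le> y" "y \<le> hi"
  shows "accum qs x + (y - x) * (E x * qs x) \<le> accum qs y"
    and "accum qs y \<le> accum qs x + (y - x) * (E y * qs y)"
    and "0 \<le> accum qs x"
proof -
  let ?g = "\<lambda>y. E y * qs y"
  have VI: "?g integrable_on {a..b}" if "lo \<le> a" "b \<le> hi" for a b
    using that by (intro integrable_on_mono_on mono_on_subset[OF E_qs_mono]) auto
  have A: "accum qs z = integral {lo..z} ?g" if "z \<in> {lo..hi}" for z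
  proof -
    have "integrable N (\<lambda>y. ?g y * indicator {lo..z} y)"
      using that by (intro integrable_real_mult_indicator integrable_E_qs) (auto simp: sets_restrict_space_iff)
    from has_integral_integral_lebesgue_on[OF this]
    have "((\<lambda>y. ?g y * indicator {lo..z} y) has_integral accum qs z) {lo..hi}"
      by (simp add: accum_def)
    also have "(\<lambda>y. ?g y * indicator {lo..z} y) = (\<lambda>y. if y \<in> {lo..z} then ?g y else 0)"
      by (auto simp: fun_eq_iff)
    finally have "(?g has_integral accum qs z) {lo..z}"
      using that by (subst (asm) has_integral_restrict) auto
    then show ?thesis by (rule integral_unique[symmetric])
  qed
  have comb: "accum qs y = accum qs x + integral {x..y} ?g"
    using assms VI Henstock_Kurzweil_Integration.integral_combine[of lo x y ?g] by (simp add: A)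
  have "integral {x..y} (\<lambda>_. ?g x) \<le> integral {x..y} ?g"
    using assms VI mono_onD[OF E_qs_mono] by (intro integral_le) auto
  then show "accum qs x + (y - x) * ?g x \<le> accum qs y"
    using comb assms by (simp add: algebra_simps)
  have "integral {x..y} ?g \<le> integral {x..y} (\<lambda>_. ?g y)"
    using assms VI mono_onD[OF E_qs_mono] by (intro integral_le) auto
  then show "accum qs y \<le> accum qs x + (y - x) * ?g y"
    using comb assms by (simp add: algebra_simps)
  show "0 \<le> accum qs x"
    using assms VI by (auto simp: A qs_nonneg less_imp_le intro!: integral_nonneg)
qed

lemma feasible_qs_ts: "feasible lo hi l qs ts"
proof -
  let ?A = "accum qs"
  have A_mono: "mono_on {lo..hi} ?A"
  proof (rule mono_onI)
    fix x y assume xy: "x \<in> {lo..hi}" "y \<in> {lo..hi}" "x \<le> y"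
    then have "0 \<le> (y - x) * (E x * qs x)" by (simp add: qs_nonneg less_imp_le)
    with accum_qs_bounds(1)[of x y] xy show "?A x \<le> ?A y" by auto
  qed
  have [measurable]: "(\<lambda>x. x) \<in> borel_measurable (restrict_space borel {lo..hi})"
    by (rule measurable_restrict_space1) simp
  have "ts \<in> borel_measurable (restrict_space borel {lo..hi})"
    unfolding ts_def[abs_def] using E_borel qs_borel borel_measurable_mono_on_fnc[OF A_mono]
    by (intro borel_measurable_diff borel_measurable_times borel_measurable_divide) auto
  then have mech: "mechanism lo hi qs ts"
    using qs_borel by (simp add: mechanism_def universally_measurable_if_borel qs_nonneg)
  have "auth_rate l x' x * (x * qs x' - ts x') \<le> x * qs x - ts x"
    if x: "x \<in> {lo..hi}" "x' \<in> {lo..hi}" for x x'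
  proof (cases "x' \<le> x")
    case True
    have "E x' * (x * qs x' - ts x') = ?A x' + (x - x') * (E x' * qs x')"
      by (simp add: ts_def algebra_simps)
    also have "\<dots> \<le> ?A x" using accum_qs_bounds(1)[of x' x] x True by auto
    finally show ?thesis
      using x True by (simp add: auth_rate_E ts_def divide_right_mono less_imp_le)
  next
    case False
    \<comment> \<open>Imitating a larger type would not pay even if authentication were certain. The
      rate, at most 1, then only lowers a nonnegative bound.\<close>
    have EE: "E x \<le> E x'" using mono_onD[OF E_mono] x False by simp
    have "E x' * (x * qs x' - ts x') = ?A x' - (x' - x) * (E x' * qs x')"
      by (simp add: ts_def algebra_simps)
    also have "\<dots> \<le> ?A x" using accum_qs_bounds(2)[of x x'] x False by auto
    finally have "x * qs x' - ts x' \<le> ?A x / E x'" by (simp add: field_simps)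
    also have "\<dots> \<le> ?A x / E x"
      using EE accum_qs_bounds(3)[of x x] x by (intro divide_left_mono) auto
    finally have le: "x * qs x' - ts x' \<le> ?A x / E x" .
    have "E x / E x' * (x * qs x' - ts x') \<le> E x / E x' * (?A x / E x)"
      by (intro mult_left_mono le) (simp add: less_imp_le)
    also have "\<dots> \<le> 1 * (?A x / E x)"
      using EE accum_qs_bounds(3)[of x x] x by (intro mult_right_mono) (auto simp: less_imp_le)
    finally show ?thesis
      using x False by (simp add: auth_rate_E ts_def)
  qed
  moreover have "0 \<le> x * qs x - ts x" if "x \<in> {lo..hi}" for x
    using accum_qs_bounds(3)[of x x] that by (simp add: ts_def less_imp_le)
  ultimately show ?thesis using mech by (simp add: feasible_def)
qed

section \<open>The profit bound, its attainment and uniqueness\<close>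

text \<open>
The bracket integrates to zero by Fubini. It is kept because \<open>\<phi> x * q x * f x\<close> alone need not be
integrable: \<open>f\<close> and \<open>q\<close> may both be unbounded.
\<close>
definition profit_bound :: "(real \<Rightarrow> real) \<Rightarrow> real \<Rightarrow> real" where
  "profit_bound q x = surplus x * f x + (E x * q x * tail x - accum q x * (f x / E x))"

lemma profit_bound_integral:
  assumes "integrable N (\<lambda>y. E y * q y)"
  shows "integrable N (profit_bound q)"
    and "(\<integral>x. profit_bound q x \<partial>N) = (\<integral>x. surplus x * f x \<partial>N)"
  using Fubini_triangle[OF assms integrable_f_div_E] integrable_surplus_f
  by (simp_all add: profit_bound_def[abs_def] accum_def tail_def)

text \<open>Splits the gap to the bound into the virtual surplus forgone by \<open>q\<close> and the
  rent paid above its minimum. Under feasibility both are nonnegative.\<close>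

lemma profit_density_eq:
  assumes "x \<in> {lo..hi}"
  shows "(t x - c (q x)) * f x = profit_bound q x
    - (surplus x - (\<phi> x * q x - c (q x)) + (x * q x - t x - accum q x / E x)) * f x"
proof -
  have "E x * tail x = (x - \<phi> x) * f x"
    using virtual_value_times_f[OF assms] by (simp add: algebra_simps)
  then have "E x * q x * tail x = (x - \<phi> x) * f x * q x"
    by (metis mult.assoc mult.commute)
  then show ?thesis by (simp add: profit_bound_def algebra_simps)
qed

lemma borel_measurable_profit_density:
  assumes "feasible lo hi l q t"
  shows "(\<lambda>x. (t x - c (q x)) * f x) \<in> borel_measurable N"
proof -
  have [measurable]: "q \<in> borel_measurable N" "t \<in> borel_measurable N"
    and q0: "\<And>x. x \<in> {lo..hi} \<Longrightarrow> 0 \<le> q x"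
    using assms by (auto simp: feasible_def mechanism_def borel_measurable_lebesgue_on_if_universally)
  \<comment> \<open>The cost is controlled on \<open>{0..}\<close> only; composing with
    \<open>max 0\<close> gives a function continuous on the whole line that agrees with it at every
    quantity of the mechanism.\<close>
  have "continuous_on {0..} c"
    using c_deriv by (intro DERIV_continuous_on) auto
  then have "continuous_on UNIV (\<lambda>z. c (max 0 z))"
    by (rule continuous_on_compose2) (auto intro!: continuous_on_max)
  then have [measurable]: "(\<lambda>z. c (max 0 z)) \<in> borel_measurable borel"
    by (rule borel_measurable_continuous_onI)
  have "(\<lambda>x. (t x - c (max 0 (q x))) * f x) \<in> borel_measurable N" by measurable
  then show ?thesis
    by (rule measurable_cong[THEN iffD1, rotated]) (simp add: q0 max_absorb2)
qed

text \<open>Nonnegative losses keep the profit density below \<open>profit_bound q\<close>, whose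
  integral does not depend on \<open>q\<close>. Attaining the bound forces both losses to vanish
  almost everywhere, since \<open>f\<close> is positive.\<close>

lemma profit_le:
  assumes "feasible lo hi l q t"
  shows "profit lo hi f c q t \<le> ereal (\<integral>x. surplus x * f x \<partial>N)"
    and "ereal (\<integral>x. surplus x * f x \<partial>N) \<le> profit lo hi f c q t \<Longrightarrow>
      AE x in N. q x = qs x \<and> t x = ts x"
proof -
  let ?P = "\<lambda>x. (t x - c (q x)) * f x"
  let ?loss = "\<lambda>x. surplus x - (\<phi> x * q x - c (q x)) + (x * q x - t x - accum q x / E x)"
  have q0: "\<And>x. x \<in> {lo..hi} \<Longrightarrow> 0 \<le> q x"
    using assms by (auto simp: feasible_def mechanism_def)
  note int = profit_bound_integral[OF feasible_imp_accum_le(1)[OF assms]]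
  have parts: "\<phi> x * q x - c (q x) \<le> surplus x" "accum q x / E x \<le> x * q x - t x"
    if "x \<in> {lo..hi}" for x
    using that surplus_ge q0 feasible_imp_accum_le(2)[OF assms] by auto
  have AE_le: "AE x in N. ?P x \<le> profit_bound q x"
  proof (intro AE_I2)
    fix x assume "x \<in> space N"
    then have x: "x \<in> {lo..hi}" by simp
    have "0 \<le> ?loss x * f x"
      using parts[OF x] f_pos[OF x] by (intro mult_nonneg_nonneg) auto
    then show "?P x \<le> profit_bound q x" using profit_density_eq[OF x, of t q] by linarith
  qed
  note dominated = nn_integral_diff_dominated[OF borel_measurable_profit_density[OF assms] int(1) AE_le,
      folded profit_def, unfolded int(2)]
  show "profit lo hi f c q t \<le> ereal (\<integral>x. surplus x * f x \<partial>N)"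
    by (rule dominated(1))
  assume "ereal (\<integral>x. surplus x * f x \<partial>N) \<le> profit lo hi f c q t"
  then have AE_eq: "AE x in N. ?P x = profit_bound q x" by (rule dominated(2))
  have AE1: "AE x in N. q x = qs x \<and> x * q x - t x = accum q x / E x"
    using AE_eq
  proof (rule lebesgue_on_mono)
    fix x assume eq: "?P x = profit_bound q x" and x: "x \<in> {lo..hi}"
    have "?loss x * f x = 0" using profit_density_eq[OF x, of t q] eq by linarith
    then have "?loss x = 0" using f_pos[OF x] by simp
    with parts[OF x] have "\<phi> x * q x - c (q x) = surplus x" "x * q x - t x = accum q x / E x"
      by linarith+
    with surplus_greater[OF x q0[OF x]] show "q x = qs x \<and> x * q x - t x = accum q x / E x"
      by auto
  qed
  have [measurable]: "q \<in> borel_measurable N" "qs \<in> borel_measurable N"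
    using assms qs_borel by (auto simp: feasible_def mechanism_def
        borel_measurable_lebesgue_on_if_universally borel_measurable_lebesgue_on_if_borel)
  \<comment> \<open>An integral ignores null sets, so almost everywhere equal quantities have the
    same minimal rents at every type. This determines the transfers.\<close>
  have accum_eq: "accum q x = accum qs x" if x: "x \<in> {lo..hi}" for x
  proof -
    have [measurable]: "{lo..x} \<in> sets N" using x by (auto simp: sets_restrict_space_iff)
    show ?thesis
      unfolding accum_def using AE1 by (intro integral_cong_AE) auto
  qed
  show "AE x in N. q x = qs x \<and> t x = ts x"
    using AE1 by (rule lebesgue_on_mono) (auto simp: ts_def accum_eq[symmetric])
qed

text \<open>For the candidate both losses vanish identically, so its profit density is exactly the
  bound.\<close>

lemma profit_qs_ts: "profit lo hi f c qs ts = ereal (\<integral>x. surplus x * f x \<partial>N)"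
proof -
  have eq: "(ts x - c (qs x)) * f x = profit_bound qs x" if "x \<in> space N" for x
    using profit_density_eq[of x ts qs] that by (simp add: ts_def surplus_def)
  note int = profit_bound_integral[OF integrable_E_qs]
  have "integrable N (\<lambda>x. (ts x - c (qs x)) * f x)"
    using int(1) eq by (subst Bochner_Integration.integrable_cong[OF refl]) auto
  moreover have "(\<integral>x. (ts x - c (qs x)) * f x \<partial>N) = (\<integral>x. profit_bound qs x \<partial>N)"
    by (rule Bochner_Integration.integral_cong[OF refl eq])
  ultimately show ?thesis
    unfolding profit_def by (subst ereal_integral_eq_nn_integral_diff) (simp_all add: int(2))
qed

lemma optimal_qs_ts: "optimal lo hi l f c qs ts"
  using feasible_qs_ts profit_le(1) by (simp add: optimal_def profit_qs_ts)

lemma optimal_unique: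
  assumes "optimal lo hi l f c q t"
  shows "AE x in type_distribution lo hi f. q x = qs x \<and> t x = ts x"
proof -
  have "AE x in N. q x = qs x \<and> t x = ts x"
    using assms feasible_qs_ts by (intro profit_le(2)) (auto simp: optimal_def profit_qs_ts[symmetric])
  then show ?thesis
    unfolding type_distribution_def by (subst AE_density) auto
qed

end

theorem proposition5:
  fixes lo hi :: real
    and l f c c' :: "real \<Rightarrow> real"
    and L :: ereal
  assumes types: "0 \<le> lo" "lo < hi"
    and precision: "continuous_on {lo..hi} l" "\<And>\<theta>. \<theta> \<in> {lo..hi} \<Longrightarrow> 0 \<le> l \<theta>"
    and density: "f \<in> borel_measurable (restrict_space borel {lo..hi})"
      "\<And>\<theta>. \<theta> \<in> {lo..hi} \<Longrightarrow> 0 < f \<theta>"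
      "prob_space (type_distribution lo hi f)"
    and cost: "\<And>x. 0 \<le> x \<Longrightarrow> 0 \<le> c x"
      "convex_on {0..} c"
      "\<And>x. 0 \<le> x \<Longrightarrow> (c has_real_derivative c' x) (at x within {0..})"
    and marginal_cost: "c' 0 = 0"
      "strict_mono_on {0..} c'"
      "((\<lambda>x. ereal (c' x)) \<longlongrightarrow> L) at_top" "L > ereal hi"
    and regular: "mono_on {lo..hi} (virtual_value hi l f)"
  shows "\<exists>q t. optimal lo hi l f c q t
      \<and> (\<forall>\<theta>\<in>{lo..hi}. c' (q \<theta>) = max (virtual_value hi l f \<theta>) 0)
      \<and> (\<forall>\<theta>\<in>{lo..hi}. t \<theta> = \<theta> * q \<theta> - (LBINT \<xi>=ereal lo..ereal \<theta>. auth_rate l \<xi> \<theta> * q \<xi>))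
      \<and> (\<forall>q' t'. optimal lo hi l f c q' t' \<longrightarrow>
           (AE \<theta> in type_distribution lo hi f. q' \<theta> = q \<theta> \<and> t' \<theta> = t \<theta>))"
proof -
  obtain M where "0 \<le> M" "hi < c' M"
  proof -
    \<comment> \<open>The order topology of \<open>ereal\<close> treats a finite and an infinite
      limit \<open>L\<close> alike.\<close>
    have "eventually (\<lambda>x. ereal hi < ereal (c' x) \<and> 0 \<le> x) at_top"
      using order_tendstoD(1)[OF marginal_cost(3,4)] eventually_ge_at_top[of 0] by (rule eventually_conj)
    then obtain M where "ereal hi < ereal (c' M) \<and> 0 \<le> M"
      using eventually_happens'[OF trivial_limit_at_top_linorder] by blast
    then show ?thesis using that by auto
  qed
  then have "\<exists>M\<ge>0. hi < c' M" by blast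
  then interpret verified_pricing lo hi l f c c'
    by (intro verified_pricing.intro assms)
  show ?thesis
    using optimal_qs_ts optimal_unique c'_qs
    by (intro exI[of _ qs] exI[of _ ts]) (auto simp: ts_def LBINT_auth_rate_eq_accum qs_borel)
qed

end
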